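(* Let $R$ be a residually solvable Lie algebra over $\mathbb{C}$ whose maximal by inclusion pro-nilpotent ideal is $\mathfrak{m}_0$, with $\mathfrak{m}_0$ of codimension $1$ in $R$. Then $R$ admits a basis $\{x,e_1,e_2,\dots\}$ on which its multiplication table is of one of the following forms: (1) $R_1(\mathfrak{m}_0,1,\beta)$: $[e_i,e_1]=e_{i+1}$ for $i\ge 2$; $[e_1,x]=e_1$; $[e_i,x]=(i-2)e_i+\sum_{k=3}^{t}\beta_k e_{i+k-2}$ for $i\ge 2$, where $\beta=(\beta_3,\beta_4,\dots,\beta_t)\in\mathbb{C}^{t-2}$ for some $t\in\mathbb{N}$; (2) $R_2(\mathfrak{m}_0,1,\beta)$: $[e_i,e_1]=e_{i+1}$ for $i\ge 2$; $[e_1,x]=e_1+\alpha_2e_2$; $[e_i,x]=((i-2)+\beta_2)e_i+\sum_{k=3}^{t}\beta_k e_{i+k-2}$ for $i\ge 2$, where $\alpha_2\in\mathbb{C}$ and $\beta=(\beta_2,\beta_3,\dots,\beta_t)\in\mathbb{C}^{t-1}$ for some $t\in\mathbb{N}$; (3) $R_3(\mathfrak{m}_0,1,\beta)$: $[e_i,e_1]=e_{i+1}$ for $i\ge 2$; $[e_i,x]=e_i+\sum_{k=3}^{t}\beta_k e_{i+k-2}$ for $i\ge 2$, where $\beta=(\beta_3,\beta_4,\dots,\beta_t)\in\mathbb{C}^{t-2}$ for some $t\in\mathbb{N}$.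
   Context: All algebras are over $\mathbb{C}$ and have a countable basis, every element being a finite linear combination of basis elements. In multiplication tables of Lie algebras, products of basis elements that are neither listed nor obtained from listed ones by antisymmetry are zero; empty sums are zero. $\mathfrak{m}_0$ is the infinite-dimensional Lie algebra with basis $\{e_1,e_2,\dots\}$ and products $[e_i,e_1]=e_{i+1}$ for $i\ge 2$. For an algebra $L$, set $L^1=L$, $L^{k+1}=[L^k,L]$ and $L^{[1]}=L$, $L^{[s+1]}=[L^{[s]},L^{[s]}]$. $L$ is residually solvable if $\bigcap_{i\ge1}L^{[i]}=0$. $L$ is pro-nilpotent if $\bigcap_{i\ge1}L^{i}=0$ and $\dim(L/L^i)<\infty$ for all $i\ge 1$. "The maximal by inclusion pro-nilpotent ideal of $R$ is $\mathfrak{m}_0$" means that $\mathfrak{m}_0$ is (isomorphic to) an ideal of $R$ that is maximal with respect to inclusion among pro-nilpotent ideals of $R$. *)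

theory Defs
  imports Complex_Main "HOL-Library.Countable_Set"
begin

text \<open>
  Lie algebras over the complex numbers, carried by a whole type; as all algebras considered
  here, they have a countable basis.
\<close>

locale complex_lie_algebra = vector_space scale
  for scale :: "complex \<Rightarrow> 'a::ab_group_add \<Rightarrow> 'a" (infixr \<open>*\<^sub>C\<close> 75) +
  fixes br :: "'a \<Rightarrow> 'a \<Rightarrow> 'a"
  assumes linear_left: "Vector_Spaces.linear scale scale (\<lambda>x. br x y)"
    and linear_right: "Vector_Spaces.linear scale scale (\<lambda>y. br x y)"
    and alternating: "br x x = 0"
    and jacobi: "br x (br y z) + br y (br z x) + br z (br x y) = 0"
    and countable_basis: "\<exists>B. countable B \<and> independent B \<and> span B = UNIV"
begin

definition lie_ideal :: "'a set \<Rightarrow> bool" where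
  "lie_ideal I \<longleftrightarrow> subspace I \<and> (\<forall>x\<in>I. \<forall>y. br x y \<in> I)"

definition bracket_space :: "'a set \<Rightarrow> 'a set \<Rightarrow> 'a set" where
  "bracket_space A B = span {br a b | a b. a \<in> A \<and> b \<in> B}"

text \<open>
  Both series are indexed from \<open>0\<close>: \<open>lower_central L k\<close> is $L^{k+1}$ and
  \<open>derived_series L s\<close> is $L^{[s+1]}$. The argument \<open>L\<close> is a subalgebra, and the series are
  those of \<open>L\<close> as an algebra in its own right.
\<close>

primrec lower_central :: "'a set \<Rightarrow> nat \<Rightarrow> 'a set" where
  "lower_central L 0 = L"
| "lower_central L (Suc k) = bracket_space (lower_central L k) L"

primrec derived_series :: "'a set \<Rightarrow> nat \<Rightarrow> 'a set" where
  "derived_series L 0 = L"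
| "derived_series L (Suc s) = bracket_space (derived_series L s) (derived_series L s)"

definition residually_solvable :: "'a set \<Rightarrow> bool" where
  "residually_solvable L \<longleftrightarrow> (\<Inter>s. derived_series L s) = {0}"

text \<open>
  For subspaces \<open>J \<subseteq> L\<close>: the cosets of the elements of \<open>B\<close> are pairwise distinct and form a
  basis of the quotient space \<open>L/J\<close>.
\<close>

definition quotient_basis :: "'a set \<Rightarrow> 'a set \<Rightarrow> 'a set \<Rightarrow> bool" where
  "quotient_basis L J B \<longleftrightarrow>
     B \<subseteq> L \<and> L \<subseteq> span (J \<union> B) \<and>
     (\<forall>F c. finite F \<and> F \<subseteq> B \<and> (\<Sum>b\<in>F. c b *\<^sub>C b) \<in> J \<longrightarrow> (\<forall>b\<in>F. c b = 0))"

definition finite_codim :: "'a set \<Rightarrow> 'a set \<Rightarrow> bool" where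
  "finite_codim L J \<longleftrightarrow> (\<exists>B. finite B \<and> quotient_basis L J B)"

definition has_codim :: "'a set \<Rightarrow> 'a set \<Rightarrow> nat \<Rightarrow> bool" where
  "has_codim L J n \<longleftrightarrow> (\<exists>B. finite B \<and> card B = n \<and> quotient_basis L J B)"

definition pro_nilpotent :: "'a set \<Rightarrow> bool" where
  "pro_nilpotent L \<longleftrightarrow>
     (\<Inter>k. lower_central L k) = {0} \<and> (\<forall>k. finite_codim L (lower_central L k))"

definition maximal_pro_nilpotent_ideal :: "'a set \<Rightarrow> bool" where
  "maximal_pro_nilpotent_ideal M \<longleftrightarrow>
     lie_ideal M \<and> pro_nilpotent M \<and>
     (\<forall>J. lie_ideal J \<and> pro_nilpotent J \<and> M \<subseteq> J \<longrightarrow> J = M)"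

text \<open>
  Sequences \<open>e\<close> stand for $e_1, e_2, \dots$; the value \<open>e 0\<close> is never used.
\<close>

definition m0_table :: "(nat \<Rightarrow> 'a) \<Rightarrow> bool" where
  "m0_table e \<longleftrightarrow>
     (\<forall>i\<ge>2. br (e i) (e 1) = e (i + 1)) \<and>
     (\<forall>i\<ge>2. \<forall>j\<ge>2. br (e i) (e j) = 0)"

definition is_m0 :: "'a set \<Rightarrow> bool" where
  "is_m0 M \<longleftrightarrow>
     (\<exists>e. inj_on e {1..} \<and> independent (e ` {1..}) \<and> span (e ` {1..}) = M \<and> m0_table e)"

definition is_basis_with :: "'a \<Rightarrow> (nat \<Rightarrow> 'a) \<Rightarrow> bool" where
  "is_basis_with x e \<longleftrightarrow>
     inj_on e {1..} \<and> x \<notin> e ` {1..} \<and>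
     independent (insert x (e ` {1..})) \<and> span (insert x (e ` {1..})) = UNIV"

text \<open>
  The tuple $(\beta_3, \dots, \beta_t)$, respectively $(\beta_2, \dots, \beta_t)$, is given by
  the corresponding values of a function \<open>\<beta>\<close>; its other values are never used.
\<close>

definition R1_table :: "'a \<Rightarrow> (nat \<Rightarrow> 'a) \<Rightarrow> nat \<Rightarrow> (nat \<Rightarrow> complex) \<Rightarrow> bool" where
  "R1_table x e t \<beta> \<longleftrightarrow>
     m0_table e \<and>
     br (e 1) x = e 1 \<and>
     (\<forall>i\<ge>2. br (e i) x = of_nat (i - 2) *\<^sub>C e i + (\<Sum>k=3..t. \<beta> k *\<^sub>C e (i + k - 2)))"

definition R2_table :: "'a \<Rightarrow> (nat \<Rightarrow> 'a) \<Rightarrow> complex \<Rightarrow> nat \<Rightarrow> (nat \<Rightarrow> complex) \<Rightarrow> bool" where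
  "R2_table x e \<alpha>\<^sub>2 t \<beta> \<longleftrightarrow>
     m0_table e \<and>
     br (e 1) x = e 1 + \<alpha>\<^sub>2 *\<^sub>C e 2 \<and>
     (\<forall>i\<ge>2. br (e i) x =
        (of_nat (i - 2) + \<beta> 2) *\<^sub>C e i + (\<Sum>k=3..t. \<beta> k *\<^sub>C e (i + k - 2)))"

definition R3_table :: "'a \<Rightarrow> (nat \<Rightarrow> 'a) \<Rightarrow> nat \<Rightarrow> (nat \<Rightarrow> complex) \<Rightarrow> bool" where
  "R3_table x e t \<beta> \<longleftrightarrow>
     m0_table e \<and>
     br (e 1) x = 0 \<and>
     (\<forall>i\<ge>2. br (e i) x = e i + (\<Sum>k=3..t. \<beta> k *\<^sub>C e (i + k - 2)))"

end

end

theory Submission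
  imports Defs
begin

text \<open>
  Pick \<open>x\<close> outside the ideal \<open>M = \<mm>\<^sub>0\<close>. The whole multiplication is then encoded in the
  derivation \<open>D y = [y, x]\<close> of \<open>M\<close>. Since \<open>M\<close> is generated by \<open>e\<^sub>1\<close> and \<open>e\<^sub>2\<close>, the Leibniz rule
  determines \<open>D\<close> by \<open>D e\<^sub>1\<close> and \<open>D e\<^sub>2\<close>; the relation \<open>[e\<^sub>3, e\<^sub>2] = 0\<close> forbids an \<open>e\<^sub>1\<close>-component in
  \<open>D e\<^sub>2\<close>, and \<open>D\<close> acts on the abelian part spanned by \<open>e\<^sub>2, e\<^sub>3, \<dots>\<close> as a diagonal operator
  with eigenvalues \<open>(i - 2) a + \<beta>\<^sub>2\<close> plus a polynomial in the shift \<open>e\<^sub>i \<mapsto> e\<^sub>i\<^sub>+\<^sub>1\<close>, where \<open>a\<close> is the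
  \<open>e\<^sub>1\<close>-coefficient of \<open>D e\<^sub>1\<close> (\<open>ad_x_form\<close>). Adding to \<open>x\<close> a combination of \<open>e\<^sub>2, e\<^sub>3, \<dots>\<close> leaves
  \<open>D e\<^sub>i\<close> unchanged for \<open>i \<ge> 2\<close> and changes \<open>D e\<^sub>1\<close> by an arbitrary combination of
  \<open>e\<^sub>3, e\<^sub>4, \<dots>\<close> (\<open>inner_derivation_onto_tail3\<close>), so only the coefficients of \<open>e\<^sub>1\<close> and \<open>e\<^sub>2\<close> in
  \<open>D e\<^sub>1\<close> matter.

  Three cases remain. If \<open>a \<noteq> 0\<close>, dividing \<open>x\<close> by \<open>a\<close> gives the second table, of which the first
  is the special case \<open>\<alpha>\<^sub>2 = \<beta>\<^sub>2 = 0\<close>. If \<open>a = 0\<close> and \<open>\<beta>\<^sub>2 \<noteq> 0\<close>, dividing \<open>x\<close> by \<open>\<beta>\<^sub>2\<close> and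
  replacing \<open>e\<^sub>1\<close> by \<open>e\<^sub>1 - c e\<^sub>2\<close> for a suitable \<open>c\<close> gives the third table. If \<open>a = \<beta>\<^sub>2 = 0\<close>, then
  every bracket with \<open>x\<close> raises the index, so the entire algebra is pro-nilpotent
  (\<open>pro_nilpotent_UNIV\<close>), contrary to the maximality of \<open>M\<close>.
\<close>

section \<open>Bilinearity, the Leibniz rule and finite codimension\<close>

context complex_lie_algebra
begin

lemma br_module_hom: "module_hom scale scale (\<lambda>a. br a b)" "module_hom scale scale (br a)"
  using linear_left[of b] linear_right[of a] by (auto simp: Vector_Spaces.linear_def)

lemmas br_add_left = module_hom.add[OF br_module_hom(1)]
  and br_add_right = module_hom.add[OF br_module_hom(2)]
  and br_diff_left = module_hom.diff[OF br_module_hom(1)]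
  and br_scale_left = module_hom.scale[OF br_module_hom(1)]
  and br_scale_right = module_hom.scale[OF br_module_hom(2)]
  and br_zero_left = module_hom.zero[OF br_module_hom(1)]
  and br_zero_right = module_hom.zero[OF br_module_hom(2)]
  and br_sum_left = module_hom.sum[OF br_module_hom(1)]

lemma br_antisym: "br a b = - br b a"
proof -
  have "br (a + b) (a + b) = br a a + br b a + (br a b + br b b)"
    by (simp only: br_add_left br_add_right)
  then have "br a b + br b a = 0"
    by (simp only: alternating add_0_left add_0_right add.commute[of "br b a"])
  then show ?thesis
    by (simp only: eq_neg_iff_add_eq_0)
qed

lemma br_minus_left: "br (- a) b = - br a b"
  by (rule module_hom.neg[OF br_module_hom(1)])

lemma br_minus_right: "br a (- b) = - br a b"
  by (rule module_hom.neg[OF br_module_hom(2)])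

lemma br_leibniz: "br (br a b) x = br (br a x) b + br a (br b x)"
proof -
  have "br (br a b) x = - br x (br a b)"
    by (rule br_antisym)
  also have "\<dots> = br a (br b x) + br b (br x a)"
    using jacobi[of a b x] by (simp add: neg_eq_iff_add_eq_0 ac_simps)
  also have "br b (br x a) = br (br a x) b"
    by (subst br_antisym, subst (2) br_antisym) (simp add: br_minus_left)
  finally show ?thesis by (simp add: add.commute)
qed

lemma br_in_subspace:
  assumes "subspace W" "\<And>a b. a \<in> A \<Longrightarrow> b \<in> B \<Longrightarrow> br a b \<in> W" "a \<in> span A" "b \<in> span B"
  shows "br a b \<in> W"
proof -
  have *: "br a b \<in> W" if "a \<in> A" for a
    using assms(4)
  proof (induction rule: span_induct)
    show "subspace {y. br a y \<in> W}"
      using assms(1) by (auto simp: subspace_def br_add_right br_scale_right br_zero_right)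
  qed (use assms(2) that in auto)
  show ?thesis
    using assms(3)
  proof (induction rule: span_induct)
    show "subspace {y. br y b \<in> W}"
      using assms(1) by (auto simp: subspace_def br_add_left br_scale_left br_zero_left)
  qed (use * in auto)
qed

text \<open>
  Among the generators \<open>F\<close> of a space modulo \<open>J\<close>, keep those that are not in the span of \<open>J\<close> and
  the generators kept so far. A finite set that spans modulo \<open>J\<close> is therefore enough to establish
  finite codimension.
\<close>

lemma subset_quotient_basis_exists:
  assumes "subspace J" "finite F"
  shows "\<exists>B\<subseteq>F. quotient_basis (span (J \<union> F)) J B"
  using assms(2)
proof (induction F)
  case empty
  show ?case by (auto simp: quotient_basis_def)
next
  case (insert f F)
  then obtain B where B: "B \<subseteq> F" "quotient_basis (span (J \<union> F)) J B" by blast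
  have sub: "span (J \<union> F) \<subseteq> span (J \<union> B)"
    using B(2) by (auto simp: quotient_basis_def intro!: span_minimal)
  show ?case
  proof (cases "f \<in> span (J \<union> B)")
    case True
    have "span (J \<union> insert f F) \<subseteq> span (J \<union> B)"
      using True sub by (intro span_minimal subspace_span) (auto intro: span_base)
    then have "quotient_basis (span (J \<union> insert f F)) J B"
      using B by (auto simp: quotient_basis_def intro: span_base)
    with B(1) show ?thesis by blast
  next
    case False
    have gen: "span (J \<union> insert f F) \<subseteq> span (J \<union> insert f B)"
    proof (intro span_minimal subspace_span)
      have "span (J \<union> B) \<subseteq> span (J \<union> insert f B)" by (intro span_mono) auto
      with sub show "J \<union> insert f F \<subseteq> span (J \<union> insert f B)"
        by (auto intro: span_base)
    qed
    have indep: "\<forall>b\<in>G. c b = 0"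
      if G: "finite G" "G \<subseteq> insert f B" and s: "(\<Sum>b\<in>G. c b *\<^sub>C b) \<in> J" for G c
    proof -
      have rest: "(\<Sum>b\<in>G - {f}. c b *\<^sub>C b) \<in> span (J \<union> B)"
        using G(2) by (intro span_sum span_scale span_base) auto
      have f0: "c f = 0" if "f \<in> G"
      proof (rule ccontr)
        assume "c f \<noteq> 0"
        have "c f *\<^sub>C f = (\<Sum>b\<in>G. c b *\<^sub>C b) - (\<Sum>b\<in>G - {f}. c b *\<^sub>C b)"
          using G(1) that by (simp add: sum.remove)
        also have "\<dots> \<in> span (J \<union> B)"
          using s rest by (intro span_diff) (auto intro: span_base)
        finally have "inverse (c f) *\<^sub>C c f *\<^sub>C f \<in> span (J \<union> B)"
          by (rule span_scale)
        with \<open>c f \<noteq> 0\<close> False show False by simp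
      qed
      then have "(\<Sum>b\<in>G - {f}. c b *\<^sub>C b) = (\<Sum>b\<in>G. c b *\<^sub>C b)"
        using G(1) by (intro sum.mono_neutral_left) auto
      with s have "(\<Sum>b\<in>G - {f}. c b *\<^sub>C b) \<in> J" by simp
      moreover have "finite (G - {f})" "G - {f} \<subseteq> B" using G by auto
      ultimately have "\<forall>b\<in>G - {f}. c b = 0"
        using B(2) unfolding quotient_basis_def by blast
      with f0 show ?thesis by auto
    qed
    have "quotient_basis (span (J \<union> insert f F)) J (insert f B)"
      unfolding quotient_basis_def using gen indep B(1) by (auto intro: span_base)
    with B(1) show ?thesis by blast
  qed
qed

end

section \<open>The normal form of the outer derivation\<close>

text \<open>
  Extensions of \<open>\<mm>\<^sub>0\<close> by one dimension, with the embedding of \<open>\<mm>\<^sub>0\<close> as an ideal expressed in terms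
  of the basis.
\<close>

locale m0_extension = complex_lie_algebra scale br
  for scale :: "complex \<Rightarrow> 'a::ab_group_add \<Rightarrow> 'a" (infixr \<open>*\<^sub>C\<close> 75) and br +
  fixes x :: 'a and e :: "nat \<Rightarrow> 'a"
  assumes inj_e: "inj_on e {1..}"
    and indep_e: "independent (e ` {1..})"
    and m0: "m0_table e"
    and x_notin: "x \<notin> span (e ` {1..})"
    and spanning: "span (insert x (e ` {1..})) = UNIV"
    and ad_x_e: "\<And>i. i \<ge> 1 \<Longrightarrow> br (e i) x \<in> span (e ` {1..})"
begin

(* Indices start at 1, and facts about e 1 should not be rewritten to speak of e (Suc 0). *)
declare One_nat_def [simp del]

abbreviation tail :: "nat \<Rightarrow> 'a set" where
  "tail n \<equiv> span (e ` {n..})"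

lemma br_e_e1: "i \<ge> 2 \<Longrightarrow> br (e i) (e 1) = e (Suc i)"
  and br_e1_e: "i \<ge> 2 \<Longrightarrow> br (e 1) (e i) = - e (Suc i)"
  and br_e_e: "i \<ge> 2 \<Longrightarrow> j \<ge> 2 \<Longrightarrow> br (e i) (e j) = 0"
  using m0 br_antisym[of "e 1" "e i"] by (simp_all add: m0_table_def flip: Suc_eq_plus1)

lemma e_in_tail: "n \<le> i \<Longrightarrow> e i \<in> tail n"
  by (intro span_base) auto

lemma tail_mono: "m \<le> n \<Longrightarrow> tail n \<subseteq> tail m"
  by (intro span_mono) auto

lemma tail_split: "v \<in> tail n \<Longrightarrow> \<exists>c w. w \<in> tail (Suc n) \<and> v = c *\<^sub>C e n + w"
proof -
  have "{n..} = insert n {Suc n..}" by auto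
  moreover assume "v \<in> tail n"
  ultimately obtain c where "v - c *\<^sub>C e n \<in> tail (Suc n)"
    by (auto simp: span_insert)
  then show ?thesis by (metis add_diff_cancel_left' diff_add_cancel add.commute)
qed

text \<open>
  The upper bound can be taken arbitrarily large by padding with zero coefficients; this provides
  a parameter \<open>t\<close> that is at least \<open>2\<close>.
\<close>

lemma tail_finite_sum: "v \<in> tail n \<Longrightarrow> \<exists>t\<ge>m. \<exists>c. v = (\<Sum>k=n..t. c k *\<^sub>C e k)"
proof (induction rule: span_induct_alt)
  case base
  show ?case by (intro exI[of _ m] conjI exI[of _ "\<lambda>_. 0"]) auto
next
  case (step a b w)
  then obtain i t c where i: "i \<ge> n" "b = e i" and t: "t \<ge> m" "w = (\<Sum>k=n..t. c k *\<^sub>C e k)"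
    by auto
  define c' where "c' k = (if k = i then a else 0) + (if k \<le> t then c k else 0)" for k
  have "(\<Sum>k=n..max i t. c' k *\<^sub>C e k) =
      (\<Sum>k=n..max i t. (if k = i then a else 0) *\<^sub>C e k)
      + (\<Sum>k=n..max i t. (if k \<le> t then c k else 0) *\<^sub>C e k)"
    by (simp add: c'_def scale_left_distrib sum.distrib)
  also have "(\<Sum>k=n..max i t. (if k = i then a else 0) *\<^sub>C e k) =
      (\<Sum>k\<in>{i}. a *\<^sub>C e k)"
    using i by (intro sum.mono_neutral_cong_right) auto
  also have "(\<Sum>k=n..max i t. (if k \<le> t then c k else 0) *\<^sub>C e k) = w"
    unfolding t(2) by (intro sum.mono_neutral_cong_right) auto
  finally have "a *\<^sub>C b + w = (\<Sum>k=n..max i t. c' k *\<^sub>C e k)"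
    using i by simp
  moreover have "max i t \<ge> m" using t by simp
  ultimately show ?case by blast
qed

lemma e_nonzero: "i \<ge> 1 \<Longrightarrow> e i \<noteq> 0"
  using indep_e dependent_zero[of "e ` {1..}"] by (metis atLeast_iff image_eqI)

text \<open>
  The identity \<open>D e\<^sub>i\<^sub>+\<^sub>1 = [D e\<^sub>i, e\<^sub>1] + [e\<^sub>i, D e\<^sub>1]\<close> propagates the shape of \<open>D e\<^sub>2\<close> to all later
  \<open>D e\<^sub>i\<close>: the first summand shifts indices by one, and the second adds \<open>a\<close> to the diagonal
  coefficient because \<open>u\<close> commutes with \<open>e\<^sub>i\<close>.
\<close>

lemma ad_x_form:
  obtains a u t \<beta> where "br (e 1) x = a *\<^sub>C e 1 + u" "u \<in> tail 2" "t \<ge> 2"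
    and "\<And>i. i \<ge> 2 \<Longrightarrow> br (e i) x =
      (of_nat (i - 2) * a + \<beta> 2) *\<^sub>C e i + (\<Sum>k=3..t. \<beta> k *\<^sub>C e (i + k - 2))"
proof -
  obtain a u where u: "u \<in> tail 2" and e1: "br (e 1) x = a *\<^sub>C e 1 + u"
    using tail_split[OF ad_x_e[of 1]] by auto
  obtain b v where v: "v \<in> tail 2" and e2: "br (e 2) x = b *\<^sub>C e 1 + v"
    using tail_split[OF ad_x_e[of 2]] by auto
  obtain t \<beta> where t: "t \<ge> 2" "v = (\<Sum>k=2..t. \<beta> k *\<^sub>C e k)"
    using tail_finite_sum[OF v, of 2] by blast
  have tail_abelian: "br p q = 0" if "p \<in> tail 2" "q \<in> tail 2" for p q
  proof -
    have "br p q \<in> {0}"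
      by (rule br_in_subspace[OF subspace_single_0 _ that]) (auto simp: br_e_e)
    then show ?thesis by simp
  qed
  have shift: "br p (e 1) \<in> tail 2" if "p \<in> tail 2" for p
    by (rule br_in_subspace[OF subspace_span _ that span_base[of _ "{e 1}"]])
      (auto simp: br_e_e1 intro!: e_in_tail)
  have e3: "e 3 = br (e 2) (e 1)"
    using br_e_e1[of 2] by (simp add: numeral_3_eq_3)
  have e3x: "br (e 3) x \<in> tail 2"
  proof -
    have "br (e 3) x = br v (e 1) + (a *\<^sub>C e 3 + br (e 2) u)"
      unfolding e3 br_leibniz[of "e 2" "e 1" x] e1 e2
      by (simp add: br_add_left br_add_right br_scale_left br_scale_right alternating)
    then show ?thesis
      using shift[OF v] tail_abelian[OF e_in_tail u] by (auto intro!: span_add span_scale e_in_tail)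
  qed
  \<comment> \<open>Applying the derivation to the relation \<open>[e\<^sub>3, e\<^sub>2] = 0\<close> leaves \<open>b e\<^sub>4\<close>.\<close>
  have "0 = br (br (e 3) (e 2)) x"
    by (simp add: br_e_e br_zero_left)
  also have "\<dots> = b *\<^sub>C e 4"
    unfolding br_leibniz[of "e 3" "e 2" x] e2
    using tail_abelian[OF e3x e_in_tail] tail_abelian[OF e_in_tail v, of 3] br_e_e1[of 3]
    by (simp add: br_add_right br_scale_right)
  finally have b: "b = 0" using e_nonzero[of 4] by simp
  have "br (e (Suc (Suc n))) x = (of_nat n * a + \<beta> 2) *\<^sub>C e (Suc (Suc n))
      + (\<Sum>k=3..t. \<beta> k *\<^sub>C e (n + k))" for n
  proof (induction n)
    case 0
    have "{2..t} = insert 2 {3..t}" using t(1) by auto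
    then show ?case using e2 t(2) b by (simp flip: numeral_2_eq_2)
  next
    case (Suc n)
    let ?i = "Suc (Suc n)"
    have "br (e (Suc ?i)) x = br (br (e ?i) (e 1)) x" by (simp add: br_e_e1)
    also have "\<dots> = br (br (e ?i) x) (e 1) + br (e ?i) (br (e 1) x)" by (rule br_leibniz)
    also have "br (br (e ?i) x) (e 1) =
        (of_nat n * a + \<beta> 2) *\<^sub>C e (Suc ?i) + (\<Sum>k=3..t. \<beta> k *\<^sub>C e (Suc n + k))"
      unfolding Suc by (simp add: br_add_left br_scale_left br_sum_left br_e_e1)
    also have "br (e ?i) (br (e 1) x) = a *\<^sub>C e (Suc ?i)"
      unfolding e1 using tail_abelian[OF e_in_tail u, of ?i]
      by (simp add: br_add_right br_scale_right br_e_e1)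
    finally show ?case
      by (simp add: scale_left_distrib algebra_simps)
  qed
  then have form: "br (e i) x = (of_nat (i - 2) * a + \<beta> 2) *\<^sub>C e i
      + (\<Sum>k=3..t. \<beta> k *\<^sub>C e (i + k - 2))" if "i \<ge> 2" for i
    using that by (auto dest!: le_Suc_ex)
  show thesis by (rule that[OF e1 u t(1) form])
qed

text \<open>
  Because \<open>[e\<^sub>1, e\<^sub>i\<^sub>-\<^sub>1] = - e\<^sub>i\<close>, correcting \<open>x\<close> by elements of the abelian part realises every
  change of \<open>D e\<^sub>1\<close> beyond \<open>e\<^sub>2\<close>. The coefficient of \<open>e\<^sub>2\<close> cannot be reached in this way, which is
  why \<open>\<alpha>\<^sub>2\<close> survives in the second table.
\<close>

lemma inner_derivation_onto_tail3:
  assumes "w \<in> tail 3"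
  shows "\<exists>y\<in>tail 1. br (e 1) y = w \<and> (\<forall>i\<ge>2. br (e i) y = 0)"
  using assms
proof (induction rule: span_induct_alt)
  case base
  show ?case by (intro bexI[of _ 0]) (auto simp: br_zero_right span_zero)
next
  case (step c b w)
  then obtain y i where y: "y \<in> tail 1" "br (e 1) y = w" "\<forall>i\<ge>2. br (e i) y = 0"
    and i: "i \<ge> 3" "b = e i" by auto
  have "br (e 1) (e (i - 1)) = - e i" "\<forall>j\<ge>2. br (e j) (e (i - 1)) = 0"
    using i br_e1_e[of "i - 1"] by (auto simp: br_e_e)
  then show ?case
    using y i
    by (intro bexI[of _ "y - c *\<^sub>C e (i - 1)"])
      (auto simp: br_add_right br_minus_right br_scale_right diff_conv_add_uminus
        simp del: add_uminus_conv_diff intro!: span_add span_neg span_scale e_in_tail)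
qed

section \<open>Changing the basis\<close>

text \<open>
  Both normalisations use the same kind of substitution, with \<open>c = 0\<close> for the second table. The
  element \<open>e\<^sub>1 - c e\<^sub>2\<close> acts on the abelian part exactly as \<open>e\<^sub>1\<close> does, so the relations of
  \<open>\<mm>\<^sub>0\<close> persist.
\<close>

lemma basis_change:
  fixes r c :: complex
  assumes r: "r \<noteq> 0" and y: "y \<in> tail 1"
  defines "e' \<equiv> e(1 := e 1 - c *\<^sub>C e 2)"
  shows "is_basis_with (r *\<^sub>C x + y) e' \<and> m0_table e'"
proof -
  have ins: "{1..} = insert 1 {2::nat..}" by auto
  have img: "e' ` {1..} = insert (e' 1) (e ` {2..})"
    unfolding ins by (auto simp: e'_def)
  have e1: "e 1 \<notin> tail 2"
  proof -
    have "e 1 \<notin> e ` {2..}"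
      using inj_e by (auto dest: inj_onD)
    then show ?thesis
      using indep_e by (simp add: ins independent_insert)
  qed
  have e'1: "e' 1 \<notin> tail 2"
  proof
    assume "e' 1 \<in> tail 2"
    then have "e' 1 + c *\<^sub>C e 2 \<in> tail 2"
      by (intro span_add span_scale e_in_tail) auto
    with e1 show False by (simp add: e'_def)
  qed
  have "independent (e ` {2..})"
    by (rule independent_mono[OF indep_e]) auto
  then have indep: "independent (e' ` {1..})"
    unfolding img using e'1 by (simp add: independent_insert)
  have inj: "inj_on e' {1..}"
  proof -
    have "inj_on e' {2..}"
      using inj_e by (auto simp: e'_def inj_on_def)
    moreover have "e' 1 \<notin> e' ` ({2..} - {1})"
      using e'1 by (auto simp: e'_def span_base)
    ultimately show ?thesis unfolding ins by simp
  qed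
  have span: "span (e' ` {1..}) = tail 1"
  proof (rule span_eq[THEN iffD2, OF conjI])
    show "e' ` {1..} \<subseteq> tail 1"
      by (auto simp: e'_def intro!: span_diff span_scale e_in_tail)
    have "e' 1 + c *\<^sub>C e 2 \<in> span (e' ` {1..})"
      unfolding img by (intro span_add span_scale span_base) auto
    then show "e ` {1..} \<subseteq> span (e' ` {1..})"
      by (auto simp: ins e'_def intro: span_base)
  qed
  have x': "r *\<^sub>C x + y \<notin> tail 1"
  proof
    assume "r *\<^sub>C x + y \<in> tail 1"
    from span_scale[OF span_diff[OF this y], of "inverse r"] r x_notin show False by simp
  qed
  then have x'_notin: "r *\<^sub>C x + y \<notin> e' ` {1..}"
    by (metis span span_base)
  have "span (insert (r *\<^sub>C x + y) (e' ` {1..})) = UNIV" (is "?S = _")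
  proof -
    have sub: "tail 1 \<subseteq> ?S"
      unfolding span[symmetric] by (intro span_mono) auto
    then have "(r *\<^sub>C x + y) - y \<in> ?S"
      using y by (intro span_diff) (auto intro: span_base)
    from span_scale[OF this, of "inverse r"] have "x \<in> ?S"
      using r by simp
    then have "insert x (e ` {1..}) \<subseteq> ?S"
      using sub by (auto intro: e_in_tail)
    from span_minimal[OF this] show ?thesis using spanning by auto
  qed
  moreover have "independent (insert (r *\<^sub>C x + y) (e' ` {1..}))"
    using indep x' x'_notin span by (simp add: independent_insert)
  ultimately have "is_basis_with (r *\<^sub>C x + y) e'"
    using inj x'_notin by (simp add: is_basis_with_def)
  moreover have "m0_table e'"
    unfolding m0_table_def e'_def
    by (auto simp: br_e_e br_e_e1 br_add_right br_minus_right br_scale_right diff_conv_add_uminus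
        simp del: add_uminus_conv_diff simp flip: Suc_eq_plus1)
  ultimately show ?thesis ..
qed

lemma R2_of_nonzero_e1_coeff:
  assumes e1: "br (e 1) x = a *\<^sub>C e 1 + u" and u: "u \<in> tail 2" and a: "a \<noteq> 0"
    and form: "\<And>i. i \<ge> 2 \<Longrightarrow> br (e i) x =
      (of_nat (i - 2) * a + \<beta> 2) *\<^sub>C e i + (\<Sum>k=3..t. \<beta> k *\<^sub>C e (i + k - 2))"
  shows "\<exists>y \<alpha> \<gamma>. is_basis_with y e \<and> R2_table y e \<alpha> t \<gamma>"
proof -
  obtain \<alpha> w where w: "w \<in> tail 3" "u = \<alpha> *\<^sub>C e 2 + w"
    using tail_split[OF u] by auto
  obtain y where y: "y \<in> tail 1" "br (e 1) y = - (1/a) *\<^sub>C w" "\<forall>i\<ge>2. br (e i) y = 0"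
    using inner_derivation_onto_tail3[OF span_scale[OF w(1)]] by metis
  have "is_basis_with ((1/a) *\<^sub>C x + y) e"
    using basis_change[OF _ y(1), of "1/a" 0] a by simp
  moreover have "R2_table ((1/a) *\<^sub>C x + y) e (\<alpha> / a) t (\<lambda>k. \<beta> k / a)"
    unfolding R2_table_def
  proof (intro conjI allI impI m0)
    show "br (e 1) ((1/a) *\<^sub>C x + y) = e 1 + (\<alpha> / a) *\<^sub>C e 2"
      using a by (simp add: br_add_right br_scale_right e1 y(2) w(2) scale_right_distrib)
    fix i :: nat assume "i \<ge> 2"
    then show "br (e i) ((1/a) *\<^sub>C x + y) = (of_nat (i - 2) + \<beta> 2 / a) *\<^sub>C e i
        + (\<Sum>k=3..t. (\<beta> k / a) *\<^sub>C e (i + k - 2))"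
      using a y(3)
      by (simp add: br_add_right br_scale_right form scale_right_distrib scale_sum_right
          add_divide_distrib)
  qed
  ultimately show ?thesis by blast
qed

text \<open>
  On the abelian part \<open>D\<close> is \<open>\<beta>\<^sub>2\<close> times the identity up to higher terms, so subtracting a multiple
  of \<open>e\<^sub>2\<close> from \<open>e\<^sub>1\<close> removes the \<open>e\<^sub>2\<close>-component of \<open>D e\<^sub>1\<close>; the error that this creates starts at
  \<open>e\<^sub>3\<close> and is absorbed by an inner derivation. Inverting \<open>D\<close> outright on the abelian part would
  in general require infinite sums.
\<close>

lemma R3_of_zero_e1_coeff:
  assumes u: "br (e 1) x \<in> tail 2" and b: "\<beta> 2 \<noteq> 0"
    and form: "\<And>i. i \<ge> 2 \<Longrightarrow> br (e i) x =
      \<beta> 2 *\<^sub>C e i + (\<Sum>k=3..t. \<beta> k *\<^sub>C e (i + k - 2))"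
  shows "\<exists>y e' \<gamma>. is_basis_with y e' \<and> R3_table y e' t \<gamma>"
proof -
  obtain \<alpha> w where w: "w \<in> tail 3" "br (e 1) x = \<alpha> *\<^sub>C e 2 + w"
    using tail_split[OF u] by auto
  define b where "b = \<beta> 2"
  define c where "c = \<alpha> / b"
  have b0: "b \<noteq> 0" using b by (simp add: b_def)
  define s where "s = (\<Sum>k=3..t. \<beta> k *\<^sub>C e k)"
  have e2: "br (e 2) x = b *\<^sub>C e 2 + s"
    using form[of 2] by (simp add: s_def b_def)
  have "s \<in> tail 3"
    unfolding s_def by (intro span_sum span_scale e_in_tail) auto
  \<comment> \<open>The derivation maps \<open>e\<^sub>1 - c e\<^sub>2\<close> to \<open>w - c s\<close>, by the choice of \<open>c\<close>.\<close>
  then have "- ((1/b) *\<^sub>C (w - c *\<^sub>C s)) \<in> tail 3"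
    using w(1) by (intro span_neg span_scale span_diff) auto
  from inner_derivation_onto_tail3[OF this]
  obtain y where y: "y \<in> tail 1" "br (e 1) y = - ((1/b) *\<^sub>C (w - c *\<^sub>C s))"
    "\<forall>i\<ge>2. br (e i) y = 0" by blast
  define x' e' where "x' = (1/b) *\<^sub>C x + y" and "e' = e(1 := e 1 - c *\<^sub>C e 2)"
  have basis: "is_basis_with x' e'" "m0_table e'"
    using basis_change[OF _ y(1), of "1/b" c] b0 by (auto simp: x'_def e'_def)
  have "br (e 1 - c *\<^sub>C e 2) x = w - c *\<^sub>C s"
    using b0 by (simp add: br_diff_left br_scale_left w(2) e2 scale_right_distrib c_def)
  moreover have "br (e 1 - c *\<^sub>C e 2) y = br (e 1) y"
    using y(3) by (simp add: br_diff_left br_scale_left)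
  ultimately have "br (e' 1) x' = 0"
    by (simp add: e'_def x'_def br_add_right br_scale_right y(2))
  moreover have "br (e' i) x' = e' i + (\<Sum>k=3..t. (\<beta> k / b) *\<^sub>C e' (i + k - 2))"
    if "i \<ge> 2" for i
  proof -
    have "(\<Sum>k=3..t. (\<beta> k / b) *\<^sub>C e' (i + k - 2)) = (\<Sum>k=3..t. (\<beta> k / b) *\<^sub>C e (i + k - 2))"
      using that by (intro sum.cong) (auto simp: e'_def)
    moreover have "br (e i) x' = e i + (\<Sum>k=3..t. (\<beta> k / b) *\<^sub>C e (i + k - 2))"
      using that b0 y(3) form[OF that, folded b_def]
      by (simp add: x'_def br_add_right br_scale_right scale_right_distrib scale_sum_right)
    ultimately show ?thesis using that by (simp add: e'_def)
  qed
  ultimately have "R3_table x' e' t (\<lambda>k. \<beta> k / b)"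
    using basis(2) by (simp add: R3_table_def)
  with basis(1) show ?thesis by blast
qed

section \<open>Pro-nilpotency when the outer derivation raises indices\<close>

lemma Inter_tail: "(\<Inter>n. tail n) = {0}"
proof -
  have "v = 0" if v: "\<And>n. v \<in> tail n" for v
  proof -
    obtain t c where t: "v = (\<Sum>k=1..t. c k *\<^sub>C e k)"
      using tail_finite_sum[OF v, of 1 1] by blast
    have v1: "v \<in> span (e ` {1..t})"
      unfolding t by (intro span_sum span_scale span_base) auto
    have disj: "e ` {1..t} \<inter> e ` {Suc t..} = {}"
      using inj_e by (fastforce dest: inj_onD)
    have "representation (e ` {1..}) v = representation (e ` {1..t}) v"
      using v1 by (intro representation_extend indep_e) auto
    moreover have "representation (e ` {1..}) v = representation (e ` {Suc t..}) v"
      using v[of "Suc t"] by (intro representation_extend indep_e) auto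
    ultimately have "representation (e ` {1..}) v b = 0" for b
      using disj representation_ne_zero by (metis disjoint_iff)
    then show ?thesis
      using sum_nonzero_representation_eq[OF indep_e v[of 1]] by simp
  qed
  then show ?thesis by (auto simp: span_zero)
qed

text \<open>
  If \<open>D\<close> raises indices, the lower central series is squeezed between two tails: brackets
  with \<open>x\<close>, \<open>e\<^sub>1\<close> or the abelian part move each tail from \<open>e\<^sub>2\<close> on to the next one, while bracketing with \<open>e\<^sub>1\<close> alone
  already produces all of the next tail. Tails have finite codimension and meet in zero.
\<close>

lemma pro_nilpotent_UNIV:
  assumes e1: "br (e 1) x \<in> tail 2"
    and e: "\<And>i. i \<ge> 2 \<Longrightarrow> br (e i) x \<in> tail (Suc i)"
  shows "pro_nilpotent UNIV"
proof -
  have gen: "insert x (e ` {1..}) = insert x (insert (e 1) (e ` {2..}))"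
  proof -
    have "{1..} = insert 1 {2::nat..}" by auto
    then show ?thesis by simp
  qed
  have xe: "br x (e i) \<in> tail (Suc i)" if "i \<ge> 1" for i
  proof (cases "i = 1")
    case True
    then show ?thesis
      using e1 br_antisym[of x "e 1"] by (simp add: span_neg)
  next
    case False
    then show ?thesis
      using e[of i] that br_antisym[of x "e i"] by (simp add: span_neg)
  qed
  have e1e: "br (e 1) (e i) \<in> tail (Suc i)" if "i \<ge> 1" for i
    using that br_e1_e[of i] by (cases "i = 1") (auto simp: alternating span_zero span_neg e_in_tail)
  have upper: "br p q \<in> tail (Suc n)" if "p \<in> tail n" "n \<ge> 2" for n p q
  proof (rule br_in_subspace[OF subspace_span _ that(1)])
    show "q \<in> span (insert x (e ` {1..}))" unfolding spanning by simp
    fix p q assume "p \<in> e ` {n..}" "q \<in> insert x (e ` {1..})"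
    then obtain i where i: "p = e i" "i \<ge> n" and q: "q \<in> insert x (insert (e 1) (e ` {2..}))"
      unfolding gen by blast
    have "br p q \<in> tail (Suc i)"
      using q i that(2) e[of i] by (auto simp: br_e_e1 br_e_e e_in_tail span_zero)
    then show "br p q \<in> tail (Suc n)" using tail_mono[of "Suc n" "Suc i"] i by auto
  qed
  have upper0: "br p q \<in> tail 2" for p q
  proof (rule br_in_subspace[OF subspace_span])
    show "p \<in> span (insert x (e ` {1..}))" "q \<in> span (insert x (e ` {1..}))"
      unfolding spanning by simp_all
    fix p q assume p: "p \<in> insert x (e ` {1..})" and q: "q \<in> insert x (e ` {1..})"
    have tail: "v \<in> tail 2" if "v \<in> tail (Suc i)" "i \<ge> 1" for v i
      using tail_mono[of 2 "Suc i"] that by auto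
    from p consider "p = x" | "p = e 1" | "p \<in> tail 2" unfolding gen by (auto intro: span_base)
    then show "br p q \<in> tail 2"
    proof cases
      case 1
      then show ?thesis using q tail[OF xe] by (auto simp: alternating span_zero)
    next
      case 2
      then show ?thesis using q e1 tail[OF e1e] by auto
    next
      case 3
      then show ?thesis using upper[OF 3, of q] tail_mono[of 2 "Suc 2"] by auto
    qed
  qed
  have lower_sub: "lower_central UNIV (Suc k) \<subseteq> tail (k + 2)" for k
  proof (induction k)
    case 0
    have "bracket_space UNIV UNIV \<subseteq> tail 2"
      unfolding bracket_space_def using upper0 by (intro span_minimal subspace_span) auto
    then show ?case by (simp flip: numeral_2_eq_2)
  next
    case (Suc k)
    show ?case
      unfolding lower_central.simps(2)[of UNIV "Suc k"] bracket_space_def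
      using upper Suc by (intro span_minimal subspace_span) fastforce
  qed
  have sup_lower: "tail (k + 2) \<subseteq> lower_central UNIV k" for k
  proof (induction k)
    case (Suc k)
    have "e i \<in> bracket_space (lower_central UNIV k) UNIV" if i: "i \<ge> Suc k + 2" for i
    proof -
      have "e i = br (e (i - 1)) (e 1)" using i br_e_e1[of "i - 1"] by simp
      moreover have "e (i - 1) \<in> lower_central UNIV k"
        using Suc e_in_tail[of "k + 2" "i - 1"] i by auto
      ultimately show ?thesis unfolding bracket_space_def by (auto intro!: span_base)
    qed
    then show ?case
      unfolding lower_central.simps bracket_space_def
      by (intro span_minimal subspace_span) auto
  qed simp
  have subspace: "subspace (lower_central UNIV k)" for k
    by (cases k) (auto simp: bracket_space_def)
  have "(\<Inter>k. lower_central UNIV k) \<subseteq> {0}"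
  proof -
    have "(\<Inter>k. lower_central UNIV k) \<subseteq> tail n" for n
      using lower_sub[of n] tail_mono[of n "n + 2"] by fastforce
    then show ?thesis unfolding Inter_tail[symmetric] by auto
  qed
  then have inter: "(\<Inter>k. lower_central UNIV k) = {0}"
    using subspace_0[OF subspace] by auto
  have codim: "finite_codim UNIV (lower_central UNIV k)" for k
  proof -
    let ?J = "lower_central UNIV k" and ?F = "insert x (e ` {1..k + 1})"
    have "insert x (e ` {1..}) \<subseteq> span (?J \<union> ?F)"
    proof -
      have "e i \<in> span (?J \<union> ?F)" if "i \<ge> 1" for i
      proof (cases "i \<le> k + 1")
        case False
        then have "e i \<in> ?J" using sup_lower[of k] e_in_tail[of "k + 2" i] by auto
        then show ?thesis by (simp add: span_base)
      qed (use that in \<open>auto intro!: span_base\<close>)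
      then show ?thesis by (auto intro: span_base)
    qed
    from span_minimal[OF this] have "span (?J \<union> ?F) = UNIV" using spanning by auto
    moreover obtain B where "B \<subseteq> ?F" "quotient_basis (span (?J \<union> ?F)) ?J B"
      using subset_quotient_basis_exists[OF subspace[of k], of ?F] by auto
    moreover from this have "finite B" by (meson finite.insertI finite_imageI finite_atLeastAtMost finite_subset)
    ultimately show ?thesis unfolding finite_codim_def by auto
  qed
  show ?thesis using inter codim by (simp add: pro_nilpotent_def)
qed

end

section \<open>The classification\<close>

theorem theorem3p1:
  fixes scale :: "complex \<Rightarrow> 'a::ab_group_add \<Rightarrow> 'a"
    and br :: "'a \<Rightarrow> 'a \<Rightarrow> 'a"
    and M :: "'a set"
  assumes "complex_lie_algebra scale br"
    and "complex_lie_algebra.residually_solvable scale br UNIV"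
    and "complex_lie_algebra.maximal_pro_nilpotent_ideal scale br M"
    and "complex_lie_algebra.is_m0 scale br M"
    and "complex_lie_algebra.has_codim scale UNIV M 1"
  shows "\<exists>x e. complex_lie_algebra.is_basis_with scale x e \<and>
     ((\<exists>t \<beta>. t \<ge> 2 \<and> complex_lie_algebra.R1_table scale br x e t \<beta>) \<or>
      (\<exists>\<alpha>\<^sub>2 t \<beta>. t \<ge> 2 \<and> complex_lie_algebra.R2_table scale br x e \<alpha>\<^sub>2 t \<beta>) \<or>
      (\<exists>t \<beta>. t \<ge> 2 \<and> complex_lie_algebra.R3_table scale br x e t \<beta>))"
proof -
  interpret complex_lie_algebra scale br by fact
  obtain e where e: "inj_on e {1..}" "independent (e ` {1..})" "span (e ` {1..}) = M" "m0_table e"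
    using assms(4) unfolding is_m0_def by blast
  obtain x where x: "quotient_basis UNIV M {x}"
    using assms(5) unfolding has_codim_def by (metis card_1_singletonE)
  have ideal: "lie_ideal M"
    and maximal: "\<And>J. lie_ideal J \<Longrightarrow> pro_nilpotent J \<Longrightarrow> M \<subseteq> J \<Longrightarrow> J = M"
    using assms(3) unfolding maximal_pro_nilpotent_ideal_def by blast+
  have x_notin_M: "x \<notin> M"
  proof
    assume "x \<in> M"
    have indep: "finite F \<and> F \<subseteq> {x} \<and> (\<Sum>b\<in>F. scale (c b) b) \<in> M \<longrightarrow> (\<forall>b\<in>F. c b = 0)" for F c
      using x unfolding quotient_basis_def by (elim conjE allE)
    show False
      using indep[of "{x}" "\<lambda>_. 1"] \<open>x \<in> M\<close> by simp
  qed
  interpret m0_extension scale br x e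
  proof
    show "span (insert x (e ` {1..})) = UNIV"
    proof -
      have "M \<union> {x} \<subseteq> span (insert x (e ` {1..}))"
        unfolding e(3)[symmetric] using span_mono[of "e ` {1..}" "insert x (e ` {1..})"]
        by (auto intro: span_base)
      from span_minimal[OF this] show ?thesis
        using x unfolding quotient_basis_def by auto
    qed
    show "br (e i) x \<in> span (e ` {1..})" if "i \<ge> 1" for i
      using ideal that span_base[of "e i" "e ` {1..}"] unfolding lie_ideal_def e(3) by auto
  qed (use e x_notin_M in auto)
  obtain a u t \<beta> where e1: "br (e 1) x = scale a (e 1) + u" "u \<in> tail 2" and t: "t \<ge> 2"
    and form: "\<And>i. i \<ge> 2 \<Longrightarrow> br (e i) x =
      scale (of_nat (i - 2) * a + \<beta> 2) (e i) + (\<Sum>k=3..t. scale (\<beta> k) (e (i + k - 2)))"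
    by (rule ad_x_form) blast
  show ?thesis
  proof (cases "a = 0")
    case False
    from R2_of_nonzero_e1_coeff[OF e1 False form] t show ?thesis by blast
  next
    case True
    have "\<beta> 2 \<noteq> 0"
    proof
      assume "\<beta> 2 = 0"
      have "br (e i) x \<in> tail (Suc i)" if "i \<ge> 2" for i
        unfolding form[OF that] using True \<open>\<beta> 2 = 0\<close>
        by (auto intro!: span_sum span_scale e_in_tail)
      then have "pro_nilpotent UNIV"
        using e1 True by (intro pro_nilpotent_UNIV) auto
      moreover have "lie_ideal UNIV" by (simp add: lie_ideal_def)
      ultimately have "UNIV = M" by (intro maximal) auto
      with x_notin_M show False by blast
    qed
    then show ?thesis
      using R3_of_zero_e1_coeff[of \<beta> t] e1 True form t by fastforce
  qed
qed

end
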